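(* Let $S_1=\epsilon_1$, $S_2=\epsilon_2$, $S_3=\epsilon_3$ and $S_n=K_{n-3}+\epsilon_3$ for $n\ge4$. For every $n\ge1$, the graph $S_n+\epsilon_3$ is minor minimal with respect to dimension $n+1$: $\dim(S_n+\epsilon_3)=n+1$ and every proper minor $H$ of $S_n+\epsilon_3$ satisfies $\dim H<n+1$.
   Context: All graphs are finite and simple; $\epsilon_k$ is the graph with $k$ vertices and no edges, $K_m$ the complete graph, and $G+H$ is obtained from disjoint copies of $G$ and $H$ by adding all edges between them. A minor of $G$ is a graph obtained by a sequence of vertex deletions, edge deletions and edge contractions (discarding loops and multiple edges). A unit-distance embedding of $G$ in $\mathbb{R}^n$ is an injective map $f$ from the vertex set to $\mathbb{R}^n$ with $|f(u)-f(v)|=1$ for every edge $uv$ and no $f(w)$ on the segment $[f(u),f(v)]$ for an edge $uv$ with $w\notin\{u,v\}$ (edges may cross one another). The dimension $\dim G$ is the least natural number $n$ such that $G$ has a unit-distance embedding in $\mathbb{R}^n$. $G$ is minor minimal with respect to dimension $d$ if $\dim G=d$ and every proper minor of $G$ has dimension less than $d$. *)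

theory Defs
  imports Complex_Main
begin

type_synonym 'a ugraph = "'a set \<times> 'a set set"

definition verts :: "'a ugraph \<Rightarrow> 'a set" where "verts G = fst G"
definition edges :: "'a ugraph \<Rightarrow> 'a set set" where "edges G = snd G"

definition wf_graph :: "'a ugraph \<Rightarrow> bool" where
  "wf_graph G \<longleftrightarrow> finite (verts G) \<and>
     (\<forall>e\<in>edges G. \<exists>u v. e = {u, v} \<and> u \<noteq> v \<and> u \<in> verts G \<and> v \<in> verts G)"

definition graph_iso :: "'a ugraph \<Rightarrow> 'b ugraph \<Rightarrow> bool" where
  "graph_iso G H \<longleftrightarrow> (\<exists>f. bij_betw f (verts G) (verts H) \<and> (\<lambda>e. f ` e) ` edges G = edges H)"

definition edgeless :: "nat \<Rightarrow> nat ugraph" where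
  "edgeless k = ({..<k}, {})"

definition complete :: "nat \<Rightarrow> nat ugraph" where
  "complete k = ({..<k}, {{i, j} | i j. i < k \<and> j < k \<and> i \<noteq> j})"

text \<open>Join G + H, for G with vertex set {0..<card (verts G)}: the vertices of H are
  shifted by card (verts G) to make the two copies disjoint, and all edges between
  the copies are added.\<close>
definition gjoin :: "nat ugraph \<Rightarrow> nat ugraph \<Rightarrow> nat ugraph" where
  "gjoin G H = (let k = card (verts G) in
     (verts G \<union> (\<lambda>v. k + v) ` verts H,
      edges G \<union> (\<lambda>e. (\<lambda>v. k + v) ` e) ` edges H \<union>
        {{u, k + v} | u v. u \<in> verts G \<and> v \<in> verts H}))"

definition del_vertex :: "'a ugraph \<Rightarrow> 'a \<Rightarrow> 'a ugraph" where
  "del_vertex G v = (verts G - {v}, {e \<in> edges G. v \<notin> e})"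

definition del_edge :: "'a ugraph \<Rightarrow> 'a set \<Rightarrow> 'a ugraph" where
  "del_edge G e = (verts G, edges G - {e})"

definition contract_edge :: "'a ugraph \<Rightarrow> 'a \<Rightarrow> 'a \<Rightarrow> 'a ugraph" where
  "contract_edge G u v = (verts G - {v},
     {e \<in> edges G. v \<notin> e} \<union> {{u, w} | w. {v, w} \<in> edges G \<and> w \<noteq> u})"

definition minor_step :: "'a ugraph \<Rightarrow> 'a ugraph \<Rightarrow> bool" where
  "minor_step H G \<longleftrightarrow>
     (\<exists>v\<in>verts G. H = del_vertex G v) \<or>
     (\<exists>e\<in>edges G. H = del_edge G e) \<or>
     (\<exists>u v. {u, v} \<in> edges G \<and> u \<noteq> v \<and> H = contract_edge G u v)"

definition proper_minor :: "'b ugraph \<Rightarrow> 'a ugraph \<Rightarrow> bool" where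
  "proper_minor H G \<longleftrightarrow> (\<exists>G'. minor_step\<^sup>+\<^sup>+ G' G \<and> graph_iso G' H)"

text \<open>Points of R^n are represented as functions nat => real vanishing at indices >= n.\<close>
definition edist :: "nat \<Rightarrow> (nat \<Rightarrow> real) \<Rightarrow> (nat \<Rightarrow> real) \<Rightarrow> real" where
  "edist n x y = sqrt (\<Sum>i<n. (x i - y i)\<^sup>2)"

definition on_segment :: "nat \<Rightarrow> (nat \<Rightarrow> real) \<Rightarrow> (nat \<Rightarrow> real) \<Rightarrow> (nat \<Rightarrow> real) \<Rightarrow> bool" where
  "on_segment n p a b \<longleftrightarrow> (\<exists>t::real. 0 \<le> t \<and> t \<le> 1 \<and> (\<forall>i<n. p i = (1 - t) * a i + t * b i))"

definition unit_dist_emb :: "'a ugraph \<Rightarrow> nat \<Rightarrow> ('a \<Rightarrow> nat \<Rightarrow> real) \<Rightarrow> bool" where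
  "unit_dist_emb G n f \<longleftrightarrow>
     inj_on f (verts G) \<and>
     (\<forall>v\<in>verts G. \<forall>i\<ge>n. f v i = 0) \<and>
     (\<forall>u v. {u, v} \<in> edges G \<longrightarrow> edist n (f u) (f v) = 1) \<and>
     (\<forall>u v w. {u, v} \<in> edges G \<longrightarrow> w \<in> verts G \<longrightarrow> w \<noteq> u \<longrightarrow> w \<noteq> v \<longrightarrow>
        \<not> on_segment n (f w) (f u) (f v))"

definition gdim :: "'a ugraph \<Rightarrow> nat" where
  "gdim G = (LEAST n. \<exists>f. unit_dist_emb G n f)"

definition S_graph :: "nat \<Rightarrow> nat ugraph" where
  "S_graph n = (if n \<le> 3 then edgeless n else gjoin (complete (n - 3)) (edgeless 3))"

end

theory Submission
  imports Defs
begin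

text \<open>Lower bound: \<open>n + 3\<close> points in \<open>\<real>\<^sup>n\<close> admit a nontrivial affine dependency \<open>l\<close> whose
  coefficients on \<open>\<epsilon>\<^sub>3\<close> also sum to 0.  For every \<open>x\<close> the sum \<open>\<Sum>l\<^sub>i |p\<^sub>i - x|\<^sup>2\<close> has the same
  value, and comparing its values at the embedded vertices forces \<open>l = 0\<close> first on \<open>\<epsilon>\<^sub>3\<close>, then on
  the clique, then on the remaining independent triple.

  Upper bounds: a graph on at most \<open>n + k\<close> vertices with \<open>k\<close> disjoint non-adjacent pairs embeds into
  the cross-polytope of \<open>\<real>\<^sup>n\<close>; this covers \<open>S\<^sub>n + \<epsilon>\<^sub>3\<close> in \<open>\<real>\<^sup>n\<^sup>+\<^sup>1\<close> for \<open>n \<ge> 2\<close> and, for \<open>n \<ge> 3\<close>,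
  \<open>S\<^sub>n + \<epsilon>\<^sub>3\<close> minus an edge in \<open>\<real>\<^sup>n\<close>, with the deleted edge as the third pair.  Every other proper
  minor has at most \<open>n + 2\<close> vertices and is not \<open>K\<close> on \<open>n + 2\<close> vertices, so it embeds into two regular
  simplices glued along a facet.\<close>

section \<open>Linear algebra and squared distances\<close>

text \<open>Gaussian elimination, by induction on the number of equations: if the last equation has
  a nonzero coefficient at some \<open>p\<close>, it determines the unknown at \<open>p\<close> in
  terms of the others, and substituting this leaves one equation and one unknown fewer.\<close>

lemma homogeneous_system_nontrivial:
  fixes A :: "nat \<Rightarrow> 'i \<Rightarrow> real"
  assumes "finite I" "m < card I"
  shows "\<exists>l. (\<exists>i\<in>I. l i \<noteq> 0) \<and> (\<forall>k<m. (\<Sum>i\<in>I. A k i * l i) = 0)"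
  using assms
proof (induction m arbitrary: I A)
  case 0
  then have "I \<noteq> {}" by auto
  then show ?case by (intro exI[of _ "\<lambda>_. 1"]) auto
next
  case (Suc m)
  show ?case
  proof (cases "\<forall>i\<in>I. A m i = 0")
    case True
    from Suc.IH[of I A] Suc.prems obtain l where
      "\<exists>i\<in>I. l i \<noteq> 0" "\<forall>k<m. (\<Sum>i\<in>I. A k i * l i) = 0" by auto
    moreover have "(\<Sum>i\<in>I. A m i * l i) = 0" using True by simp
    ultimately show ?thesis by (metis less_Suc_eq)
  next
    case False
    then obtain p where p: "p \<in> I" "A m p \<noteq> 0" by auto
    define J where "J = I - {p}"
    have J: "finite J" "m < card J" "p \<notin> J" "I = insert p J"
      using Suc.prems p by (auto simp: J_def)
    from Suc.IH[OF J(1,2), of "\<lambda>k i. A k i - A k p * A m i / A m p"] obtain l where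
      l: "\<exists>i\<in>J. l i \<noteq> 0" "\<forall>k<m. (\<Sum>i\<in>J. (A k i - A k p * A m i / A m p) * l i) = 0" by auto
    define s where "s = (\<Sum>i\<in>J. A m i * l i)"
    define l' where "l' = l(p := - s / A m p)"
    have sum_l': "(\<Sum>i\<in>I. A k i * l' i) = (\<Sum>i\<in>J. A k i * l i) - A k p * s / A m p" for k
    proof -
      have "(\<Sum>i\<in>J. A k i * l' i) = (\<Sum>i\<in>J. A k i * l i)"
        by (rule sum.cong) (use J(3) in \<open>auto simp: l'_def\<close>)
      then show ?thesis using J by (simp add: l'_def)
    qed
    have "(\<Sum>i\<in>I. A k i * l' i) = 0" if "k < Suc m" for k
    proof (cases "k = m")
      case True
      then show ?thesis using p sum_l'[of m] by (simp add: s_def)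
    next
      case False
      then have "0 = (\<Sum>i\<in>J. (A k i - A k p * A m i / A m p) * l i)" using l(2) that by simp
      also have "\<dots> = (\<Sum>i\<in>J. A k i * l i) - A k p * s / A m p"
        by (simp add: s_def algebra_simps sum_subtractf sum_distrib_left sum_divide_distrib)
      finally show ?thesis using sum_l' by simp
    qed
    moreover have "\<exists>i\<in>I. l' i \<noteq> 0" using l(1) J by (auto simp: l'_def)
    ultimately show ?thesis by blast
  qed
qed

section \<open>Squared distances and affine dependencies\<close>

definition sqdist :: "nat \<Rightarrow> (nat \<Rightarrow> real) \<Rightarrow> (nat \<Rightarrow> real) \<Rightarrow> real" where
  "sqdist n x y = (\<Sum>i<n. (x i - y i)\<^sup>2)"

lemma sqdist_nonneg: "sqdist n x y \<ge> 0"
  by (simp add: sqdist_def sum_nonneg)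

lemma sqdist_commute: "sqdist n x y = sqdist n y x"
  by (simp add: sqdist_def power2_commute)

lemma sqdist_self [simp]: "sqdist n x x = 0"
  by (simp add: sqdist_def)

lemma edist_eq_sqrt_sqdist: "edist n x y = sqrt (sqdist n x y)"
  by (simp add: edist_def sqdist_def)

lemma edist_eq_1_iff: "edist n x y = 1 \<longleftrightarrow> sqdist n x y = 1"
  by (simp add: edist_eq_sqrt_sqdist)

lemma sqdist_expand:
  "sqdist n x y = (\<Sum>q<n. (x q)\<^sup>2) + (\<Sum>q<n. (y q)\<^sup>2) - 2 * (\<Sum>q<n. x q * y q)"
  by (simp add: sqdist_def power2_diff sum.distrib sum_subtractf sum_distrib_left mult.assoc)

text \<open>After expansion, \<open>x\<close> occurs only in \<open>|x|\<^sup>2\<close> times the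
  sum of the \<open>l i\<close> and in the inner product of \<open>x\<close> with the sum of the
  \<open>l i * p i\<close>. Both vanish, so the value is the same for every
  \<open>x\<close>.\<close>

lemma sum_sqdist_affine_dependency:
  assumes "(\<Sum>i\<in>I. l i) = 0" "\<And>q. q < k \<Longrightarrow> (\<Sum>i\<in>I. l i * p i q) = 0"
  shows "(\<Sum>i\<in>I. l i * sqdist k (p i) x) = (\<Sum>i\<in>I. l i * (\<Sum>q<k. (p i q)\<^sup>2))"
proof -
  have cross: "(\<Sum>i\<in>I. l i * (\<Sum>q<k. p i q * x q)) = 0"
  proof -
    have "(\<Sum>i\<in>I. l i * (\<Sum>q<k. p i q * x q)) = (\<Sum>i\<in>I. \<Sum>q<k. l i * p i q * x q)"
      by (simp add: sum_distrib_left mult.assoc)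
    also have "\<dots> = (\<Sum>q<k. \<Sum>i\<in>I. l i * p i q * x q)" by (rule sum.swap)
    also have "\<dots> = (\<Sum>q<k. (\<Sum>i\<in>I. l i * p i q) * x q)" by (simp add: sum_distrib_right)
    finally show ?thesis using assms(2) by simp
  qed
  have "(\<Sum>i\<in>I. l i * sqdist k (p i) x) = (\<Sum>i\<in>I. l i * (\<Sum>q<k. (p i q)\<^sup>2)
      + l i * (\<Sum>q<k. (x q)\<^sup>2) - 2 * (l i * (\<Sum>q<k. p i q * x q)))"
    by (simp add: sqdist_expand algebra_simps)
  also have "\<dots> = (\<Sum>i\<in>I. l i * (\<Sum>q<k. (p i q)\<^sup>2)) + (\<Sum>i\<in>I. l i) * (\<Sum>q<k. (x q)\<^sup>2)
      - 2 * (\<Sum>i\<in>I. l i * (\<Sum>q<k. p i q * x q))"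
    by (simp add: sum.distrib sum_subtractf sum_distrib_right[symmetric] sum_distrib_left[symmetric])
  finally show ?thesis using cross assms(1) by simp
qed

text \<open>Both norm terms of \<open>|p i - p j|\<^sup>2\<close> are cancelled by the vanishing sum
  of the \<open>l i\<close>, and only the cross term survives. If the left side is 0, the vector
  with coordinates \<open>\<Sum>i\<in>I. l i * p i q\<close> must therefore be 0.\<close>

lemma sqdist_quadratic_form:
  assumes "(\<Sum>i\<in>I. l i) = 0"
  shows "(\<Sum>j\<in>I. l j * (\<Sum>i\<in>I. l i * sqdist k (p i) (p j))) = - 2 * (\<Sum>q<k. (\<Sum>i\<in>I. l i * p i q)\<^sup>2)"
proof -
  define N where "N i = (\<Sum>q<k. (p i q)\<^sup>2)" for i
  define c where "c q = (\<Sum>i\<in>I. l i * p i q)" for q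
  have swap: "(\<Sum>i\<in>I. l i * (\<Sum>q<k. p i q * y q)) = (\<Sum>q<k. c q * y q)" for y
  proof -
    have "(\<Sum>i\<in>I. l i * (\<Sum>q<k. p i q * y q)) = (\<Sum>i\<in>I. \<Sum>q<k. l i * p i q * y q)"
      by (simp add: sum_distrib_left mult.assoc)
    also have "\<dots> = (\<Sum>q<k. \<Sum>i\<in>I. l i * p i q * y q)" by (rule sum.swap)
    finally show ?thesis by (simp add: sum_distrib_right c_def)
  qed
  have row: "(\<Sum>i\<in>I. l i * sqdist k (p i) (p j)) = (\<Sum>i\<in>I. l i * N i) - 2 * (\<Sum>q<k. c q * p j q)" for j
  proof -
    have "(\<Sum>i\<in>I. l i * sqdist k (p i) (p j)) = (\<Sum>i\<in>I. l i * N i + l i * N j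
        - 2 * (l i * (\<Sum>q<k. p i q * p j q)))"
      by (simp add: sqdist_expand N_def algebra_simps)
    also have "\<dots> = (\<Sum>i\<in>I. l i * N i) + (\<Sum>i\<in>I. l i) * N j
        - 2 * (\<Sum>i\<in>I. l i * (\<Sum>q<k. p i q * p j q))"
      by (simp add: sum.distrib sum_subtractf sum_distrib_right[symmetric] sum_distrib_left[symmetric])
    finally show ?thesis using swap assms by simp
  qed
  have "(\<Sum>j\<in>I. l j * (\<Sum>i\<in>I. l i * sqdist k (p i) (p j)))
      = (\<Sum>j\<in>I. l j * (\<Sum>i\<in>I. l i * N i) - 2 * (l j * (\<Sum>q<k. p j q * c q)))"
    unfolding row by (simp add: algebra_simps)
  also have "\<dots> = (\<Sum>j\<in>I. l j) * (\<Sum>i\<in>I. l i * N i) - 2 * (\<Sum>j\<in>I. l j * (\<Sum>q<k. p j q * c q))"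
    by (simp add: sum_subtractf sum_distrib_right[symmetric] sum_distrib_left[symmetric])
  finally show ?thesis using swap assms by (simp add: c_def power2_eq_square)
qed

text \<open>A line meets a sphere in at most two points.\<close>

lemma cospherical_triple_affinely_independent:
  fixes l :: "'i \<Rightarrow> real"
  assumes "finite I" "card I \<le> 3"
    and dist: "\<And>i j. i \<in> I \<Longrightarrow> j \<in> I \<Longrightarrow> i \<noteq> j \<Longrightarrow> sqdist k (p i) (p j) > 0"
    and unit: "\<And>i. i \<in> I \<Longrightarrow> sqdist k (p i) x = 1"
    and l0: "(\<Sum>i\<in>I. l i) = 0" and lp: "\<And>q. q < k \<Longrightarrow> (\<Sum>i\<in>I. l i * p i q) = 0"
    and "i \<in> I"
  shows "l i = 0"
proof -
  \<comment> \<open>The sum does not depend on the reference point, and at the centre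
    \<open>x\<close> of the unit sphere it is 0.\<close>
  have row: "(\<Sum>i\<in>I. l i * sqdist k (p i) (p j)) = 0" for j
  proof -
    have "(\<Sum>i\<in>I. l i * sqdist k (p i) (p j)) = (\<Sum>i\<in>I. l i * sqdist k (p i) x)"
      using sum_sqdist_affine_dependency[of l I k p "p j"] sum_sqdist_affine_dependency[of l I k p x] l0 lp by simp
    also have "\<dots> = 0" using unit l0 by simp
    finally show ?thesis .
  qed
  have "card I \<noteq> 0" using assms by auto
  then consider "card I = 1" | "card I = 2" | "card I = 3" using assms(2) by linarith
  then show ?thesis
  proof cases
    case 1
    then show ?thesis using l0 \<open>i \<in> I\<close> by (auto simp: card_1_singleton_iff)
  next
    case 2
    then obtain a b where I: "I = {a, b}" "a \<noteq> b" by (auto simp: card_2_iff)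
    then have "l b * sqdist k (p b) (p a) = 0" using row[of a] by simp
    moreover have "sqdist k (p b) (p a) > 0" using dist I by auto
    ultimately show ?thesis using l0 I \<open>i \<in> I\<close> by auto
  next
    case 3
    then obtain a b c where I: "I = {a, b, c}" "a \<noteq> b" "a \<noteq> c" "b \<noteq> c" by (auto simp: card_3_iff)
    define u v w where "u = sqdist k (p a) (p b)" "v = sqdist k (p a) (p c)" "w = sqdist k (p b) (p c)"
    have pos: "u > 0" "v > 0" "w > 0" using dist I by (auto simp: u_v_w_def)
    have 1: "l b * u + l c * v = 0" using row[of a] I by (simp add: u_v_w_def sqdist_commute)
    have 2: "l a * u + l c * w = 0" using row[of b] I by (simp add: u_v_w_def sqdist_commute)
    have 3: "l a * v + l b * w = 0" using row[of c] I by (simp add: u_v_w_def sqdist_commute)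
    \<comment> \<open>The three relations form a symmetric system with zero diagonal and determinant
      \<open>2 * u * v * w\<close>; this combination eliminates \<open>l b\<close> and
      \<open>l c\<close>.\<close>
    have "2 * l a * u * v = v * (l a * u + l c * w) + u * (l a * v + l b * w) - w * (l b * u + l c * v)"
      by (simp add: algebra_simps)
    then have "l a = 0" using 1 2 3 pos by simp
    then show ?thesis using 2 3 pos I \<open>i \<in> I\<close> by auto
  qed
qed

section \<open>Embeddings\<close>

lemma wf_graph_edgeD:
  assumes "wf_graph G" "{u, v} \<in> edges G"
  shows "u \<in> verts G" "v \<in> verts G" "u \<noteq> v"
  using assms by (fastforce simp: wf_graph_def doubleton_eq_iff)+

text \<open>An embedding is pulled back along an injective homomorphism; injectivity also keeps the
  image of a third vertex different from the ends of an edge.\<close>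

lemma unit_dist_emb_transfer:
  assumes emb: "unit_dist_emb G n f" and wf: "wf_graph H"
    and inj: "inj_on g (verts H)" and gv: "g ` verts H \<subseteq> verts G"
    and ge: "\<And>u v. {u, v} \<in> edges H \<Longrightarrow> {g u, g v} \<in> edges G"
  shows "unit_dist_emb H n (f \<circ> g)"
proof -
  have ends: "u \<in> verts H \<and> v \<in> verts H" if "{u, v} \<in> edges H" for u v
    using wf that by (fastforce simp: wf_graph_def doubleton_eq_iff)
  have "inj_on (f \<circ> g) (verts H)"
    using emb inj gv by (intro comp_inj_on) (auto simp: unit_dist_emb_def intro: inj_on_subset)
  moreover have "\<not> on_segment n (f (g w)) (f (g u)) (f (g v))"
    if "{u, v} \<in> edges H" "w \<in> verts H" "w \<noteq> u" "w \<noteq> v" for u v w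
  proof -
    have "g w \<noteq> g u" "g w \<noteq> g v" using inj ends that by (auto dest: inj_onD)
    then show ?thesis using emb ge that gv by (auto simp: unit_dist_emb_def)
  qed
  ultimately show ?thesis using emb ge gv by (auto simp: unit_dist_emb_def)
qed

text \<open>Proper minors are taken up to isomorphism. The inverse isomorphism pulls
  \<open>f\<close> back to \<open>H\<close>, which inherits well-formedness from
  \<open>K\<close>.\<close>

lemma unit_dist_emb_graph_iso:
  assumes wfK: "wf_graph K" and iso: "graph_iso K H" and f: "unit_dist_emb K n f"
  shows "\<exists>f'. unit_dist_emb H n f'"
proof -
  from iso obtain h where h: "bij_betw h (verts K) (verts H)" "(\<lambda>e. h ` e) ` edges K = edges H"
    by (auto simp: graph_iso_def)
  define g where "g = inv_into (verts K) h"
  have g: "g (h a) = a" if "a \<in> verts K" for a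
    using that h(1) by (simp add: g_def bij_betw_inv_into_left)
  have edgeH: "\<exists>a b. e = {h a, h b} \<and> {a, b} \<in> edges K \<and> a \<in> verts K \<and> b \<in> verts K \<and> a \<noteq> b"
    if "e \<in> edges H" for e
  proof -
    have "e \<in> (\<lambda>e. h ` e) ` edges K" using that h(2) by simp
    then obtain e' where e': "e' \<in> edges K" "e = h ` e'" by (rule imageE)
    obtain a b where ab: "e' = {a, b}" using wfK e'(1) unfolding wf_graph_def by metis
    have "e = {h a, h b}" using e'(2) ab by simp
    then show ?thesis using e'(1) wf_graph_edgeD[OF wfK, of a b] unfolding ab by metis
  qed
  have wfH: "wf_graph H" unfolding wf_graph_def
  proof (intro conjI ballI)
    show "finite (verts H)" using bij_betw_finite[OF h(1)] wfK by (simp add: wf_graph_def)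
    fix e assume "e \<in> edges H"
    then obtain a b where ab: "e = {h a, h b}" "a \<in> verts K" "b \<in> verts K" "a \<noteq> b"
      using edgeH by blast
    then have "h a \<noteq> h b" "h a \<in> verts H" "h b \<in> verts H"
      using h(1) by (auto simp: bij_betw_def dest: inj_onD)
    then show "\<exists>u v. e = {u, v} \<and> u \<noteq> v \<and> u \<in> verts H \<and> v \<in> verts H" using ab(1) by blast
  qed
  have "unit_dist_emb H n (f \<circ> g)"
  proof (rule unit_dist_emb_transfer[OF f wfH])
    show "inj_on g (verts H)" "g ` verts H \<subseteq> verts K"
      using bij_betw_inv_into[OF h(1)] by (auto simp: bij_betw_def g_def)
    show "{g u, g v} \<in> edges K" if uv: "{u, v} \<in> edges H" for u v
    proof -
      obtain a b where ab: "{u, v} = {h a, h b}" "{a, b} \<in> edges K" "a \<in> verts K" "b \<in> verts K"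
        using edgeH[OF uv] by blast
      then have "{g u, g v} = {a, b}" using g by (auto simp: doubleton_eq_iff)
      then show ?thesis using ab(2) by simp
    qed
  qed
  then show ?thesis by blast
qed

text \<open>Points at mutual distance at least 1 never lie inside a segment of length 1.\<close>

lemma unit_dist_emb_separated:
  assumes wf: "wf_graph G"
    and zero: "\<And>v i. v \<in> verts G \<Longrightarrow> i \<ge> n \<Longrightarrow> f v i = 0"
    and edge: "\<And>u v. u \<in> verts G \<Longrightarrow> v \<in> verts G \<Longrightarrow> u \<noteq> v \<Longrightarrow> {u, v} \<in> edges G \<Longrightarrow> sqdist n (f u) (f v) = 1"
    and sep: "\<And>u v. u \<in> verts G \<Longrightarrow> v \<in> verts G \<Longrightarrow> u \<noteq> v \<Longrightarrow> sqdist n (f u) (f v) \<ge> 1"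
  shows "unit_dist_emb G n f"
proof -
  have ends: "u \<in> verts G \<and> v \<in> verts G \<and> u \<noteq> v" if "{u, v} \<in> edges G" for u v
    using wf that by (fastforce simp: wf_graph_def doubleton_eq_iff)
  have "inj_on f (verts G)"
  proof (rule inj_onI, rule ccontr)
    fix u v assume "u \<in> verts G" "v \<in> verts G" "f u = f v" "u \<noteq> v"
    then show False using sep[of u v] by simp
  qed
  moreover have "\<not> on_segment n (f w) (f u) (f v)"
    if e: "{u, v} \<in> edges G" and w: "w \<in> verts G" "w \<noteq> u" "w \<noteq> v" for u v w
  proof
    assume "on_segment n (f w) (f u) (f v)"
    then obtain t where t: "0 \<le> t" "t \<le> 1" "\<And>i. i < n \<Longrightarrow> f w i = (1 - t) * f u i + t * f v i"
      by (auto simp: on_segment_def)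
    \<comment> \<open>The point with parameter \<open>t\<close> on a unit segment has distance
      \<open>t\<close> from \<open>f u\<close>. Separation from \<open>f u\<close> forces
      \<open>t = 1\<close>, and then the point coincides with \<open>f v\<close>.\<close>
    have "sqdist n (f w) (f u) = (\<Sum>i<n. t\<^sup>2 * (f v i - f u i)\<^sup>2)"
      unfolding sqdist_def by (intro sum.cong) (auto simp: t(3) power2_eq_square algebra_simps)
    also have "\<dots> = t\<^sup>2 * sqdist n (f v) (f u)" by (simp add: sqdist_def sum_distrib_left)
    also have "\<dots> = t\<^sup>2" using edge[of u v] ends[OF e] e by (simp add: sqdist_commute)
    finally have "t\<^sup>2 \<ge> 1" using sep[of w u] w ends[OF e] by simp
    then have "t = 1" using t(1,2) by (smt (verit) power_le_one_iff power2_eq_square mult_left_le)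
    then have "sqdist n (f w) (f v) = 0" using t(3) by (simp add: sqdist_def)
    then show False using sep[of w v] w ends[OF e] by simp
  qed
  ultimately show ?thesis using zero edge ends by (auto simp: unit_dist_emb_def edist_eq_1_iff)
qed

section \<open>Cross-polytopes and pairs of glued simplices\<close>

lemma sqdist_scaled_axes:
  assumes "a < n" "b < n"
  shows "sqdist n (\<lambda>i. if i = a then s else 0) (\<lambda>i. if i = b then t else 0)
    = (if a = b then (s - t)\<^sup>2 else s\<^sup>2 + t\<^sup>2)"
proof -
  have "sqdist n (\<lambda>i. if i = a then s else 0) (\<lambda>i. if i = b then t else 0)
    = (\<Sum>i<n. (if i = a then s\<^sup>2 else 0)) + (\<Sum>i<n. (if i = b then t\<^sup>2 else 0))
      - 2 * (\<Sum>i<n. if i = a then (if a = b then s * t else 0) else 0)"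
    unfolding sqdist_expand by (intro arg_cong2[of _ _ _ _ "(-)"] arg_cong2[of _ _ _ _ "(+)"]
        arg_cong[of _ _ "\<lambda>x. 2 * x"] sum.cong) auto
  then show ?thesis using assms by (simp add: power2_diff)
qed

text \<open>The vertices of a cross-polytope of edge length 1: each non-adjacent pair
  \<open>{y, mate y}\<close> shares an axis, every other vertex has an axis of its own.\<close>

lemma cross_polytope_embedding:
  assumes wf: "wf_graph G" and Y: "Y \<subseteq> verts G" "inj_on mate Y" "mate ` Y \<subseteq> verts G - Y"
    and nonadj: "\<And>y. y \<in> Y \<Longrightarrow> {y, mate y} \<notin> edges G"
    and card: "card (verts G - Y) \<le> n"
  shows "\<exists>f. unit_dist_emb G n f"
proof -
  have "finite (verts G - Y)" using wf by (simp add: wf_graph_def)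
  then obtain h where h: "h ` (verts G - Y) \<subseteq> {..<n}" "inj_on h (verts G - Y)"
    using card card_le_inj[of "verts G - Y" "{..<n}"] by auto
  define axis where "axis v = h (if v \<in> Y then mate v else v)" for v
  \<comment> \<open>With this scale, points on different axes have squared distance 1/2 + 1/2, and
    opposite points on one axis have squared distance 2, so no pair is closer than 1.\<close>
  define s where "s v = (if v \<in> Y then - 1 else 1) * (1 / sqrt 2 :: real)" for v
  define f where "f v = (\<lambda>i. if i = axis v then s v else 0)" for v
  have axis: "axis v < n" if "v \<in> verts G" for v
  proof -
    have "(if v \<in> Y then mate v else v) \<in> verts G - Y" using that Y by auto
    then show ?thesis using h(1) by (auto simp: axis_def)
  qed
  have s2: "(s v)\<^sup>2 = 1 / 2" for v by (simp add: s_def power_divide)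
  have same: "(u \<in> Y \<and> v \<notin> Y \<and> v = mate u) \<or> (v \<in> Y \<and> u \<notin> Y \<and> u = mate v)"
    if "u \<in> verts G" "v \<in> verts G" "u \<noteq> v" "axis u = axis v" for u v
  proof -
    have "(if u \<in> Y then mate u else u) = (if v \<in> Y then mate v else v)"
      using that Y by (intro inj_onD[OF h(2)]) (auto simp: axis_def)
    then show ?thesis using that inj_onD[OF Y(2), of u v] by (auto split: if_splits)
  qed
  have d: "sqdist n (f u) (f v) = (if axis u = axis v then (s u - s v)\<^sup>2 else 1)"
    if "u \<in> verts G" "v \<in> verts G" for u v
    unfolding f_def using sqdist_scaled_axes[OF axis axis, OF that] by (simp add: s2)
  have "unit_dist_emb G n f"
  proof (rule unit_dist_emb_separated[OF wf])
    show "f v i = 0" if "v \<in> verts G" "i \<ge> n" for v i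
      using axis[of v] that by (auto simp: f_def)
    show "sqdist n (f u) (f v) = 1"
      if "u \<in> verts G" "v \<in> verts G" "u \<noteq> v" "{u, v} \<in> edges G" for u v
      using d[of u v] same[of u v] that nonadj[of u] nonadj[of v] by (auto simp: insert_commute)
    show "sqdist n (f u) (f v) \<ge> 1" if "u \<in> verts G" "v \<in> verts G" "u \<noteq> v" for u v
      using d[of u v] same[of u v] that by (auto simp: s_def power_divide power2_eq_square)
  qed
  then show ?thesis by blast
qed

text \<open>The facet \<open>e\<^sub>i / sqrt 2\<close> (\<open>i < n\<close>) of a regular simplex of side 1, with its two possible
  apices on the diagonal as the points \<open>n\<close> and \<open>n + 1\<close>.  The diagonal coordinate \<open>c\<close> solves
  \<open>n c\<^sup>2 - sqrt 2 c - 1/2 = 0\<close>.\<close>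

definition double_simplex :: "nat \<Rightarrow> nat \<Rightarrow> nat \<Rightarrow> real" where
  "double_simplex n j = (\<lambda>i. if j < n then (if i = j then 1 / sqrt 2 else 0)
     else if i < n then (sqrt 2 + (if j = n then 1 else - 1) * sqrt (2 + 2 * n)) / (2 * n) else 0)"

text \<open>All pairs are at distance 1 except the two apices, whose squared distance is
  \<open>(2 + 2 * n) / n\<close>. This still exceeds 1, as separation requires.\<close>

lemma sqdist_double_simplex:
  assumes "n \<ge> 1" "i < j" "j < n + 2"
  shows "(i, j) \<noteq> (n, n + 1) \<Longrightarrow> sqdist n (double_simplex n i) (double_simplex n j) = 1"
    and "sqdist n (double_simplex n i) (double_simplex n j) \<ge> 1"
proof -
  define c :: "nat \<Rightarrow> real" where
    "c j = (sqrt 2 + (if j = n then 1 else - 1) * sqrt (2 + 2 * n)) / (2 * n)" for j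
  have apex: "double_simplex n j = (\<lambda>i. if i < n then c j else 0)" if "\<not> j < n" for j
    using that by (auto simp: double_simplex_def c_def)
  have base: "double_simplex n j = (\<lambda>i. if i = j then 1 / sqrt 2 else 0)" if "j < n" for j
    using that by (auto simp: double_simplex_def)
  have c: "n * (c j)\<^sup>2 - sqrt 2 * c j = 1 / 2" for j
  proof -
    define r where "r = (if j = n then 1 else - 1) * sqrt (2 + 2 * real n)"
    have r2: "r\<^sup>2 = 2 + 2 * real n" by (auto simp: r_def power_mult_distrib)
    have cr: "2 * n * c j = sqrt 2 + r" using assms(1) by (simp add: c_def r_def)
    \<comment> \<open>Multiplication by \<open>4 * n\<close> allows completing the square in
      \<open>2 * n * c j\<close>, so that the sign of the root \<open>r\<close> no longer
      matters.\<close>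
    have "4 * n * (n * (c j)\<^sup>2 - sqrt 2 * c j) = (2 * n * c j)\<^sup>2 - 2 * sqrt 2 * (2 * n * c j)"
      by (simp add: power2_eq_square algebra_simps)
    also have "\<dots> = r\<^sup>2 - 2" unfolding cr by (simp add: power2_eq_square algebra_simps)
    also have "\<dots> = 4 * n * (1 / 2)" using r2 by simp
    finally show ?thesis using assms(1) by (simp only: mult_cancel_left) simp
  qed
  have unit: "sqdist n (double_simplex n i) (double_simplex n j) = 1" if "i < n"
  proof (cases "j < n")
    case True
    then show ?thesis using assms that
      by (simp add: base sqdist_scaled_axes power_divide)
  next
    case False
    have "sqdist n (double_simplex n i) (double_simplex n j)
      = (\<Sum>q<n. if q = i then 1 / 2 else 0) + (\<Sum>q<n. (c j)\<^sup>2)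
        - 2 * (\<Sum>q<n. if q = i then c j / sqrt 2 else 0)"
      unfolding sqdist_expand base[OF that] apex[OF False]
      by (intro arg_cong2[of _ _ _ _ "(-)"] arg_cong2[of _ _ _ _ "(+)"]
        arg_cong[of _ _ "\<lambda>x. 2 * x"] sum.cong) (auto simp: power_divide)
    also have "\<dots> = 1 / 2 + (n * (c j)\<^sup>2 - 2 * c j / sqrt 2)" using that by simp
    also have "2 * c j / sqrt 2 = sqrt 2 * c j" by (simp add: field_simps)
    finally show ?thesis using c by simp
  qed
  have apices: "sqdist n (double_simplex n i) (double_simplex n j) \<ge> 1" if "\<not> i < n"
  proof -
    have ij: "i = n" "j = n + 1" using assms that by auto
    have "sqdist n (double_simplex n i) (double_simplex n j) = n * (c n - c (n + 1))\<^sup>2"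
      by (simp add: sqdist_def apex ij)
    also have "c n - c (n + 1) = sqrt (2 + 2 * n) / n"
      using assms(1) by (simp add: c_def field_simps)
    also have "n * (sqrt (2 + 2 * n) / n)\<^sup>2 = (2 + 2 * n) / n"
      using assms(1) by (simp add: power_divide power2_eq_square field_simps)
    also have "\<dots> \<ge> 1" using assms(1) by (simp add: field_simps)
    finally show ?thesis .
  qed
  show "(i, j) \<noteq> (n, n + 1) \<Longrightarrow> sqdist n (double_simplex n i) (double_simplex n j) = 1"
    using unit assms by auto
  show "sqdist n (double_simplex n i) (double_simplex n j) \<ge> 1"
    using unit apices by fastforce
qed

lemma double_simplex_embedding:
  assumes wf: "wf_graph G" and "n \<ge> 1" and inj: "inj_on g (verts G)"
    and g: "g ` verts G \<subseteq> {..<n + 2}"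
    and nonadj: "\<And>u v. u \<in> verts G \<Longrightarrow> v \<in> verts G \<Longrightarrow> g u = n \<Longrightarrow> g v = n + 1 \<Longrightarrow> {u, v} \<notin> edges G"
  shows "unit_dist_emb G n (double_simplex n \<circ> g)"
proof (rule unit_dist_emb_separated[OF wf])
  show "(double_simplex n \<circ> g) v i = 0" if "v \<in> verts G" "i \<ge> n" for v i
    using that by (auto simp: double_simplex_def)
next
  fix u v assume uv: "u \<in> verts G" "v \<in> verts G" "u \<noteq> v"
  have lt: "g u < n + 2" "g v < n + 2" using uv g by auto
  have "g u \<noteq> g v" using uv inj by (auto dest: inj_onD)
  then consider "g u < g v" | "g v < g u" by linarith
  note cs = this
  show "sqdist n ((double_simplex n \<circ> g) u) ((double_simplex n \<circ> g) v) \<ge> 1"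
    using cs by cases (use sqdist_double_simplex(2)[OF \<open>n \<ge> 1\<close>, of "g u" "g v"]
        sqdist_double_simplex(2)[OF \<open>n \<ge> 1\<close>, of "g v" "g u"] lt in \<open>auto simp: sqdist_commute\<close>)
  assume e: "{u, v} \<in> edges G"
  have "(g u, g v) \<noteq> (n, n + 1)" "(g v, g u) \<noteq> (n, n + 1)"
    using nonadj[of u v] nonadj[of v u] uv e by (auto simp: insert_commute)
  then show "sqdist n ((double_simplex n \<circ> g) u) ((double_simplex n \<circ> g) v) = 1"
    using cs by cases (use sqdist_double_simplex(1)[OF \<open>n \<ge> 1\<close>, of "g u" "g v"]
        sqdist_double_simplex(1)[OF \<open>n \<ge> 1\<close>, of "g v" "g u"] lt in \<open>auto simp: sqdist_commute\<close>)
qed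

text \<open>One apex is enough: the \<open>n + 1\<close> points of a regular simplex are pairwise at
  distance 1, whatever the edges are.\<close>

lemma small_graph_embedding:
  assumes wf: "wf_graph G" and "n \<ge> 1" and "card (verts G) \<le> n + 1"
  shows "\<exists>f. unit_dist_emb G n f"
proof -
  have "finite (verts G)" using wf by (simp add: wf_graph_def)
  then obtain g where "g ` verts G \<subseteq> {..<n + 1}" "inj_on g (verts G)"
    using assms(3) card_le_inj[of "verts G" "{..<n + 1}"] by auto
  then show ?thesis
    using double_simplex_embedding[OF wf \<open>n \<ge> 1\<close>, of g] by fastforce
qed

text \<open>The non-adjacent pair goes to the two apices, the other \<open>n\<close> vertices to the
  common facet.\<close>

lemma incomplete_graph_embedding:
  assumes wf: "wf_graph G" and "n \<ge> 1" and card: "card (verts G) = n + 2"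
    and xy: "x \<in> verts G" "y \<in> verts G" "x \<noteq> y" "{x, y} \<notin> edges G"
  shows "\<exists>f. unit_dist_emb G n f"
proof -
  have fin: "finite (verts G)" using wf by (simp add: wf_graph_def)
  have "card (verts G - {x, y}) = n" using xy card fin by (simp add: card_Diff_subset)
  then obtain h where "h ` (verts G - {x, y}) \<subseteq> {..<n}" and hinj: "inj_on h (verts G - {x, y})"
    using fin card_le_inj[of "verts G - {x, y}" "{..<n}"] by auto
  then have h: "h v < n" if "v \<in> verts G" "v \<noteq> x" "v \<noteq> y" for v using that by auto
  define g where "g = h(x := n, y := n + 1)"
  have "unit_dist_emb G n (double_simplex n \<circ> g)"
  proof (rule double_simplex_embedding[OF wf \<open>n \<ge> 1\<close>])
    show "inj_on g (verts G)"
    proof (rule inj_onI)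
      fix u v assume "u \<in> verts G" "v \<in> verts G" "g u = g v"
      then show "u = v"
        using h[of u] h[of v] inj_onD[OF hinj, of u v] by (auto simp: g_def split: if_splits)
    qed
    show "g ` verts G \<subseteq> {..<n + 2}"
      using h by (force simp: g_def)
    show "{u, v} \<notin> edges G" if "u \<in> verts G" "v \<in> verts G" "g u = n" "g v = n + 1" for u v
      using that h[of u] h[of v] xy by (auto simp: g_def split: if_splits)
  qed
  then show ?thesis by blast
qed

section \<open>Minors\<close>

lemma wf_graph_minor_step:
  assumes wf: "wf_graph G" and "minor_step H G"
  shows "wf_graph H"
  using assms(2) unfolding minor_step_def
proof (elim disjE bexE exE conjE)
  fix v assume "H = del_vertex G v"
  then show ?thesis using wf
    by (fastforce simp: wf_graph_def del_vertex_def verts_def edges_def)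
next
  fix e assume "H = del_edge G e"
  then show ?thesis using wf by (auto simp: wf_graph_def del_edge_def verts_def edges_def)
next
  fix u v assume uv: "{u, v} \<in> edges G" "u \<noteq> v" and H: "H = contract_edge G u v"
  have verts: "verts H = verts G - {v}" by (simp add: H contract_edge_def verts_def)
  have edges: "edges H = {e \<in> edges G. v \<notin> e} \<union> {{u, w} | w. {v, w} \<in> edges G \<and> w \<noteq> u}"
    by (simp add: H contract_edge_def edges_def)
  show ?thesis unfolding wf_graph_def verts edges
  proof (intro conjI ballI)
    show "finite (verts G - {v})" using wf by (simp add: wf_graph_def)
    fix e assume "e \<in> {e \<in> edges G. v \<notin> e} \<union> {{u, w} | w. {v, w} \<in> edges G \<and> w \<noteq> u}"
    then show "\<exists>a b. e = {a, b} \<and> a \<noteq> b \<and> a \<in> verts G - {v} \<and> b \<in> verts G - {v}"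
    proof
      assume "e \<in> {e \<in> edges G. v \<notin> e}"
      then show ?thesis using wf by (fastforce simp: wf_graph_def)
    next
      assume "e \<in> {{u, w} | w. {v, w} \<in> edges G \<and> w \<noteq> u}"
      then obtain w where w: "e = {u, w}" "{v, w} \<in> edges G" "w \<noteq> u" by auto
      then show ?thesis using wf_graph_edgeD[OF wf w(2)] wf_graph_edgeD[OF wf uv(1)] uv(2)
        by (intro exI[of _ u] exI[of _ w]) auto
    qed
  qed
qed

text \<open>Vertex deletion and edge contraction are treated together: \<open>u = v\<close> stands
  for deletion, while in a contraction \<open>v\<close> is merged into \<open>u\<close>. In either
  case no edge is created away from \<open>u\<close> and \<open>v\<close>.\<close>

lemma minor_step_cases:
  assumes wf: "wf_graph G" and "minor_step H G"
  obtains (edge) e where "e \<in> edges G" "verts H = verts G" "edges H = edges G - {e}"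
  | (vertex) u v where "v \<in> verts G" "verts H = verts G - {v}" "u = v \<or> {u, v} \<in> edges G"
      "\<And>x y. x \<notin> {u, v} \<Longrightarrow> y \<notin> {u, v} \<Longrightarrow> {x, y} \<in> edges H \<Longrightarrow> {x, y} \<in> edges G"
  using assms(2) unfolding minor_step_def
proof (elim disjE bexE exE conjE)
  fix v assume "v \<in> verts G" "H = del_vertex G v"
  then show thesis by (intro vertex[of v v]) (auto simp: del_vertex_def verts_def edges_def)
next
  fix e assume "e \<in> edges G" "H = del_edge G e"
  then show thesis by (intro edge[of e]) (auto simp: del_edge_def verts_def edges_def)
next
  fix u v assume "{u, v} \<in> edges G" "u \<noteq> v" "H = contract_edge G u v"
  then show thesis using wf_graph_edgeD[OF wf]
    by (intro vertex[of v u]) (auto simp: contract_edge_def verts_def edges_def doubleton_eq_iff)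
qed

text \<open>Two of three independent vertices survive the deletion of a vertex or the contraction of an
  edge, hence a minor that is one vertex short is not complete.\<close>

lemma proper_minor_cases:
  assumes wf: "wf_graph G" and A: "A \<subseteq> verts G" "card A = 3"
    and indep: "\<And>x y. x \<in> A \<Longrightarrow> y \<in> A \<Longrightarrow> {x, y} \<notin> edges G"
    and minor: "minor_step\<^sup>+\<^sup>+ H G"
  shows "wf_graph H \<and>
    (verts H = verts G \<and> edges H \<subset> edges G \<or>
     card (verts H) + 1 = card (verts G) \<and> (\<exists>x\<in>verts H. \<exists>y\<in>verts H. x \<noteq> y \<and> {x, y} \<notin> edges H) \<or>
     card (verts H) + 2 \<le> card (verts G))"
proof -
  have fin: "finite (verts G)" using wf by (simp add: wf_graph_def)
  \<comment> \<open>Allowing any \<open>K\<close> with the full vertex set covers the first step as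
    well as a step that follows only edge deletions.\<close>
  have one_step: "verts H = verts G \<and> edges H \<subset> edges G \<or>
     card (verts H) + 1 = card (verts G) \<and> (\<exists>x\<in>verts H. \<exists>y\<in>verts H. x \<noteq> y \<and> {x, y} \<notin> edges H)"
    if K: "wf_graph K" "verts K = verts G" "edges K \<subseteq> edges G" and "minor_step H K" for H K
    using K(1) that(4)
  proof (cases rule: minor_step_cases)
    case (edge e)
    then have "edges H \<subset> edges G" using K(3) by blast
    then show ?thesis using edge(2) K(2) by simp
  next
    case (vertex u v)
    have "\<not> (u \<in> A \<and> v \<in> A) \<or> u = v" using vertex indep K(3) by blast
    then have "card (A \<inter> {u, v}) \<le> 1"
    proof
      assume "u = v"
      then show ?thesis by (simp add: Int_insert_right)
    qed (auto simp: Int_insert_right)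
    moreover have "card (A - {u, v}) = card A - card (A \<inter> {u, v})"
      using card_Diff_subset_Int[of A "{u, v}"] by simp
    ultimately have "card (A - {u, v}) \<ge> 2" using A(2) by simp
    then obtain x y where xy: "x \<in> A - {u, v}" "y \<in> A - {u, v}" "x \<noteq> y"
      by (auto simp: numeral_2_eq_2 card_le_Suc_iff)
    have "{x, y} \<notin> edges H" using xy indep[of x y] vertex(4)[of x y] K(3) by auto
    moreover have "x \<in> verts H" "y \<in> verts H" using xy vertex(2) K(2) A(1) by auto
    moreover have "card (verts H) + 1 = card (verts G)"
      using card_Suc_Diff1[OF fin, of v] vertex(1,2) K(2) by (metis Suc_eq_plus1)
    ultimately show ?thesis using xy(3) by blast
  qed
  from minor show ?thesis
  proof (induction rule: converse_tranclp_induct)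
    case (base H)
    then show ?case using one_step[OF wf refl order_refl base] wf_graph_minor_step[OF wf base] by blast
  next
    case (step H K)
    have wfK: "wf_graph K" using step.IH by blast
    have wfH: "wf_graph H" by (rule wf_graph_minor_step[OF wfK step(1)])
    have finK: "finite (verts K)" using wfK by (simp add: wf_graph_def)
    show ?case
    proof (cases "verts K = verts G \<and> edges K \<subset> edges G")
      case True
      then show ?thesis using one_step[of K H, OF wfK _ _ step(1)] wfH by (metis psubset_imp_subset)
    next
      \<comment> \<open>Here \<open>K\<close> has already lost a vertex. Deleting an edge preserves
        the vertex count and any non-adjacent pair; losing another vertex leads to the last
        alternative.\<close>
      case False
      from wfK step(1) show ?thesis
      proof (cases rule: minor_step_cases)
        case (edge e)
        then have "edges H \<subseteq> edges K" by blast
        then show ?thesis using step.IH False wfH edge(2) by (metis subsetD)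
      next
        case (vertex u v)
        then have "card (verts H) + 1 = card (verts K)"
          using card_Suc_Diff1[OF finK, of v] by (metis Suc_eq_plus1)
        then show ?thesis using step.IH False wfH by linarith
      qed
    qed
  qed
qed

section \<open>The graphs \<open>S\<^sub>n + \<epsilon>\<^sub>3\<close>\<close>

lemma verts_gjoin_edgeless:
  assumes "verts G = {..<k}"
  shows "verts (gjoin G (edgeless m)) = {..<k + m}"
proof -
  have "verts (gjoin G (edgeless m)) = {..<k} \<union> (\<lambda>v. k + v) ` {..<m}"
    using assms by (simp add: gjoin_def Let_def verts_def[of "(_, _)"] edgeless_def)
  also have "(\<lambda>v. k + v) ` {..<m} = {k..<k + m}"
    using image_add_atLeastLessThan[of k 0 m] by (simp add: lessThan_atLeast0 add.commute)
  also have "{..<k} \<union> {k..<k + m} = {..<k + m}" by auto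
  finally show ?thesis .
qed

lemma verts_S_graph [simp]: "verts (S_graph n) = {..<n}"
proof (cases "n \<le> 3")
  case False
  then show ?thesis
    using verts_gjoin_edgeless[of "complete (n - 3)" "n - 3" 3]
    by (simp add: S_graph_def complete_def verts_def)
qed (simp add: S_graph_def edgeless_def verts_def)

lemma verts_S_join [simp]: "verts (gjoin (S_graph n) (edgeless 3)) = {..<n + 3}"
  by (rule verts_gjoin_edgeless) simp

lemma edges_gjoin_edgeless:
  assumes "verts G = {..<k}" "\<And>u v. {u, v} \<in> edges G \<Longrightarrow> u < k \<and> v < k"
  shows "{i, j} \<in> edges (gjoin G (edgeless m)) \<longleftrightarrow>
    {i, j} \<in> edges G \<or> i < k \<and> k \<le> j \<and> j < k + m \<or> j < k \<and> k \<le> i \<and> i < k + m"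
proof -
  have "edges (gjoin G (edgeless m)) = edges G \<union> {{u, k + v} | u v. u < k \<and> v < m}"
    using assms(1) by (simp add: gjoin_def Let_def edges_def[of "(_, _)"] edgeless_def verts_def[of "(_, _)"])
  moreover have "{i, j} \<in> {{u, k + v} | u v. u < k \<and> v < m} \<longleftrightarrow>
    i < k \<and> k \<le> j \<and> j < k + m \<or> j < k \<and> k \<le> i \<and> i < k + m" (is "?L \<longleftrightarrow> ?R")
  proof
    assume ?L
    then show ?R by (auto simp: doubleton_eq_iff)
  next
    assume ?R
    then show ?L
    proof
      assume "i < k \<and> k \<le> j \<and> j < k + m"
      then show ?L by (intro CollectI exI[of _ i] exI[of _ "j - k"]) auto
    next
      assume "j < k \<and> k \<le> i \<and> i < k + m"
      then show ?L by (intro CollectI exI[of _ j] exI[of _ "i - k"]) auto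
    qed
  qed
  ultimately show ?thesis by blast
qed

lemma edges_complete: "{i, j} \<in> edges (complete k) \<longleftrightarrow> i < k \<and> j < k \<and> i \<noteq> j"
  by (auto simp: complete_def edges_def doubleton_eq_iff)

text \<open>For \<open>n \<le> 3\<close> the truncated difference \<open>n - 3\<close> is 0, so that \<open>{n - 3..<n}\<close> is all of
  \<open>S\<^sub>n\<close> and there is no clique part.\<close>

lemma edges_S_graph:
  "{i, j} \<in> edges (S_graph n) \<longleftrightarrow> i < n \<and> j < n \<and> i \<noteq> j \<and> \<not> (n - 3 \<le> i \<and> n - 3 \<le> j)"
proof (cases "n \<le> 3")
  case True
  then show ?thesis by (auto simp: S_graph_def edgeless_def edges_def)
next
  case False
  have "verts (complete (n - 3)) = {..<n - 3}" by (simp add: complete_def verts_def)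
  then have "{i, j} \<in> edges (gjoin (complete (n - 3)) (edgeless 3)) \<longleftrightarrow>
    i < n - 3 \<and> j < n - 3 \<and> i \<noteq> j \<or> i < n - 3 \<and> n - 3 \<le> j \<and> j < n - 3 + 3 \<or>
    j < n - 3 \<and> n - 3 \<le> i \<and> i < n - 3 + 3"
    by (subst edges_gjoin_edgeless) (auto simp: edges_complete)
  then show ?thesis using False by (auto simp: S_graph_def)
qed

lemma edges_S_join:
  "{i, j} \<in> edges (gjoin (S_graph n) (edgeless 3)) \<longleftrightarrow> i < n + 3 \<and> j < n + 3 \<and> i \<noteq> j \<and>
     \<not> (n \<le> i \<and> n \<le> j) \<and> \<not> (i \<in> {n - 3..<n} \<and> j \<in> {n - 3..<n})"
proof -
  have "{i, j} \<in> edges (gjoin (S_graph n) (edgeless 3)) \<longleftrightarrow>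
    {i, j} \<in> edges (S_graph n) \<or> i < n \<and> n \<le> j \<and> j < n + 3 \<or> j < n \<and> n \<le> i \<and> i < n + 3"
    by (rule edges_gjoin_edgeless) (auto simp: edges_S_graph)
  moreover obtain m where "n - 3 = m" "m \<le> n" by simp
  ultimately show ?thesis using edges_S_graph[of i j n] by (cases "i < n"; cases "j < n") auto
qed

lemma wf_graph_S_join: "wf_graph (gjoin (S_graph n) (edgeless 3))"
proof -
  have "\<exists>u v. e = {u, v}" if "e \<in> edges (gjoin (S_graph n) (edgeless 3))" for e
    using that by (auto simp: S_graph_def gjoin_def edgeless_def complete_def edges_def Let_def
        split: if_splits)
  then show ?thesis unfolding wf_graph_def
    by (metis edges_S_join finite_lessThan lessThan_iff verts_S_join)
qed

text \<open>The system \<open>\<Sum>l i p\<^sub>i = 0\<close>, \<open>\<Sum>l i = 0\<close>, \<open>\<Sum>\<^bsub>i \<ge> n\<^esub> l i = 0\<close> has \<open>k + 2 < n + 3\<close> equations.\<close>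

lemma S_join_embedding_bound:
  assumes emb: "unit_dist_emb (gjoin (S_graph n) (edgeless 3)) k f" and "n \<ge> 1"
  shows "k \<ge> n + 1"
proof (rule ccontr)
  assume "\<not> k \<ge> n + 1"
  then have "k + 2 < card {..<n + 3}" by simp
  define I A S where "I = {..<n + 3}" "A = {n..<n + 3}" "S = {..<n}"
  have fin: "finite I" "finite A" "finite S" and I: "I = A \<union> S" "A \<inter> S = {}"
    by (auto simp: I_A_S_def)
  define d where "d i j = sqdist k (f i) (f j)" for i j
  have d1: "d i j = 1" if "{i, j} \<in> edges (gjoin (S_graph n) (edgeless 3))" for i j
    using emb that by (auto simp: unit_dist_emb_def edist_eq_1_iff d_def)
  have dSA: "d i j = 1" "d j i = 1" if "i \<in> S" "j \<in> A" for i j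
    using that by (auto intro!: d1 simp: edges_S_join I_A_S_def)
  have dpos: "d i j > 0" if "i \<in> I" "j \<in> I" "i \<noteq> j" for i j
  proof (rule ccontr)
    assume "\<not> d i j > 0"
    then have "d i j = 0" using sqdist_nonneg[of k "f i" "f j"] by (simp add: d_def)
    then have "f i q = f j q" if "q < k" for q
      using that by (simp add: d_def sqdist_def sum_nonneg_eq_0_iff)
    moreover have "f i q = f j q" if "q \<ge> k" for q
      using emb that \<open>i \<in> I\<close> \<open>j \<in> I\<close> by (simp add: unit_dist_emb_def I_A_S_def)
    ultimately have "f i = f j" by (meson ext not_le)
    then show False using emb that by (auto simp: unit_dist_emb_def I_A_S_def dest: inj_onD)
  qed
  \<comment> \<open>Rows below \<open>k\<close> express the coordinates of the dependency, row
    \<open>k\<close> its total weight, and row \<open>k + 1\<close> its weight on \<open>A\<close>,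
    the copy of \<open>\<epsilon>\<^sub>3\<close>.\<close>
  define M :: "nat \<Rightarrow> nat \<Rightarrow> real" where
    "M q i = (if q < k then f i q else if q = k then 1 else if i \<in> A then 1 else 0)" for q i
  obtain l where l: "\<exists>i\<in>I. l i \<noteq> 0" "\<And>q. q < k + 2 \<Longrightarrow> (\<Sum>i\<in>I. M q i * l i) = 0"
    using homogeneous_system_nontrivial[of I "k + 2" M] \<open>k + 2 < card {..<n + 3}\<close>
    by (auto simp: I_A_S_def)
  have lp: "(\<Sum>i\<in>I. l i * f i q) = 0" if "q < k" for q
    using l(2)[of q] that by (simp add: M_def mult.commute)
  have lI: "(\<Sum>i\<in>I. l i) = 0" using l(2)[of k] by (simp add: M_def)
  have lA: "(\<Sum>i\<in>A. l i) = 0"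
  proof -
    have "(\<Sum>i\<in>I. M (k + 1) i * l i) = (\<Sum>i\<in>I. if i \<in> A then l i else 0)"
      by (intro sum.cong) (auto simp: M_def)
    also have "\<dots> = (\<Sum>i\<in>A. l i)" using fin I by (simp add: sum.If_cases Int_Un_distrib2)
    finally show ?thesis using l(2)[of "k + 1"] by simp
  qed
  have split: "(\<Sum>i\<in>I. g i) = (\<Sum>i\<in>A. g i) + (\<Sum>i\<in>S. g i)" for g :: "nat \<Rightarrow> real"
    using fin I by (simp add: sum.union_disjoint)
  have lS: "(\<Sum>i\<in>S. l i) = 0" using lI lA split[of l] by simp
  define c where "c = (\<Sum>i\<in>I. l i * (\<Sum>q<k. (f i q)\<^sup>2))"
  \<comment> \<open>A vertex of \<open>A\<close> has distance 1 from all of \<open>S\<close>, where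
    the weights sum to 0; so the part over \<open>A\<close> alone already equals the common value
    \<open>c\<close>.\<close>
  have "(\<Sum>i\<in>A. l i * d i j) = c" if "j \<in> A" for j
  proof -
    have "(\<Sum>i\<in>S. l i * d i j) = 0" using dSA that lS by simp
    moreover have "(\<Sum>i\<in>I. l i * d i j) = c"
      unfolding d_def c_def by (rule sum_sqdist_affine_dependency[OF lI lp])
    ultimately show ?thesis using split by simp
  qed
  \<comment> \<open>Weighting the constant \<open>c\<close> with coefficients of sum 0 gives 0, so
    by the quadratic form identity \<open>l\<close> restricted to \<open>A\<close> is itself an
    affine dependency.\<close>
  then have "(\<Sum>j\<in>A. l j * (\<Sum>i\<in>A. l i * d i j)) = 0"
    using lA by (simp flip: sum_distrib_right)
  then have "(\<Sum>q<k. (\<Sum>i\<in>A. l i * f i q)\<^sup>2) = 0"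
    using sqdist_quadratic_form[OF lA, of k f] by (simp add: d_def)
  then have vA: "(\<Sum>i\<in>A. l i * f i q) = 0" if "q < k" for q
    using that by (simp add: sum_nonneg_eq_0_iff)
  \<comment> \<open>Vertex 0 belongs to \<open>S\<close>, so the three points of \<open>A\<close>
    lie on the unit sphere around \<open>f 0\<close>.\<close>
  have l0A: "l i = 0" if "i \<in> A" for i
  proof (rule cospherical_triple_affinely_independent[of A k f "f 0" l])
    show "sqdist k (f i) (f j) > 0" if "i \<in> A" "j \<in> A" "i \<noteq> j" for i j
      using dpos that I by (simp add: d_def)
    show "sqdist k (f i) (f 0) = 1" if "i \<in> A" for i
      using dSA(2)[of 0 i] that \<open>n \<ge> 1\<close> by (simp add: d_def I_A_S_def)
  qed (use that lA vA in \<open>auto simp: I_A_S_def\<close>)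
  have vS: "(\<Sum>i\<in>S. l i * f i q) = 0" if "q < k" for q
    using split[of "\<lambda>i. l i * f i q"] lp vA that by simp
  \<comment> \<open>A clique vertex \<open>j\<close> has distance 1 from every other vertex of
    \<open>S\<close> and 0 from itself, so summing against \<open>f j\<close> gives
    \<open>- l j\<close>. Summing against \<open>f n\<close>, with \<open>n\<close> in
    \<open>A\<close>, gives 0, and the two values agree.\<close>
  have l0C: "l j = 0" if "j < n - 3" for j
  proof -
    have j: "j \<in> S" using that by (simp add: I_A_S_def)
    have "d i j = 1" if "i \<in> S - {j}" for i
      using that \<open>j < n - 3\<close> by (intro d1) (auto simp: edges_S_join I_A_S_def)
    then have "(\<Sum>i\<in>S. l i * d i j) = (\<Sum>i\<in>S. l i) - l j"
      using j fin by (simp add: sum.remove[of S j] d_def)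
    moreover have "(\<Sum>i\<in>S. l i * d i j) = (\<Sum>i\<in>S. l i * d i n)"
      unfolding d_def using sum_sqdist_affine_dependency[OF lS vS] by simp
    moreover have "(\<Sum>i\<in>S. l i * d i n) = 0" using dSA lS by (simp add: I_A_S_def)
    ultimately show ?thesis using lS by simp
  qed
  \<comment> \<open>The dependency is now supported on the independent part of \<open>S\<close>, at
    most three points on the unit sphere around \<open>f n\<close>.\<close>
  define B where "B = {n - 3..<n}"
  have toB: "(\<Sum>i\<in>B. l i * g i) = (\<Sum>i\<in>S. l i * g i)" for g
    using l0C by (intro sum.mono_neutral_left) (auto simp: B_def I_A_S_def)
  have "l i = 0" if "i \<in> B" for i
  proof (rule cospherical_triple_affinely_independent[of B k f "f n" l])
    show "sqdist k (f i) (f j) > 0" if "i \<in> B" "j \<in> B" "i \<noteq> j" for i j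
      using dpos that by (simp add: d_def B_def I_A_S_def)
    show "sqdist k (f i) (f n) = 1" if "i \<in> B" for i
      using dSA(1)[of i n] that by (simp add: d_def B_def I_A_S_def)
    show "(\<Sum>i\<in>B. l i) = 0" using toB[of "\<lambda>_. 1"] lS by simp
    show "(\<Sum>i\<in>B. l i * f i q) = 0" if "q < k" for q
      using toB[of "\<lambda>i. f i q"] vS that by simp
  qed (use that in \<open>auto simp: B_def\<close>)
  then have "l i = 0" if "i \<in> I" for i
    using that l0A[of i] l0C[of i]
    by (cases "i \<in> A"; cases "i < n - 3") (auto simp: B_def I_A_S_def)
  then show False using l(1) by blast
qed

text \<open>For \<open>n \<ge> 2\<close> the disjoint non-adjacent pairs \<open>{n, n + 1}\<close>
  and \<open>{n - 1, n - 2}\<close> save two axes of the cross-polytope. For \<open>n = 1\<close>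
  the graph is the claw, in which any two non-adjacent pairs share a leaf, so it is drawn
  directly.\<close>

lemma S_join_embedding:
  assumes "n \<ge> 1"
  shows "\<exists>f. unit_dist_emb (gjoin (S_graph n) (edgeless 3)) (n + 1) f"
proof (cases "n = 1")
  case True
  \<comment> \<open>The centre 0 lies at the origin, the leaves 1, 2, 3 at (1, 0), (-1, 0), (0,
    1).\<close>
  define f :: "nat \<Rightarrow> nat \<Rightarrow> real" where
    "f v i = (if i = 0 then (if v = 1 then 1 else if v = 2 then - 1 else 0)
       else if i = 1 then (if v = 3 then 1 else 0) else 0)" for v i
  have V: "v = 0 \<or> v = 1 \<or> v = 2 \<or> v = 3" if "v < n + 3" for v using that True by linarith
  have d: "sqdist (n + 1) (f i) (f j) = (f i 0 - f j 0)\<^sup>2 + (f i 1 - f j 1)\<^sup>2" for i j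
    by (simp add: sqdist_def True numeral_2_eq_2)
  have "unit_dist_emb (gjoin (S_graph n) (edgeless 3)) (n + 1) f"
  proof (rule unit_dist_emb_separated[OF wf_graph_S_join])
    fix i j assume "i \<in> verts (gjoin (S_graph n) (edgeless 3))"
      "j \<in> verts (gjoin (S_graph n) (edgeless 3))" and ne: "i \<noteq> j"
    then have ij: "i = 0 \<or> i = 1 \<or> i = 2 \<or> i = 3" "j = 0 \<or> j = 1 \<or> j = 2 \<or> j = 3"
      using V by auto
    show "sqdist (n + 1) (f i) (f j) \<ge> 1"
      using ij ne unfolding d by (elim disjE) (simp_all add: f_def power2_eq_square)
    assume "{i, j} \<in> edges (gjoin (S_graph n) (edgeless 3))"
    then have "i = 0 \<or> j = 0" using True by (auto simp: edges_S_join)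
    then show "sqdist (n + 1) (f i) (f j) = 1"
      using ij ne unfolding d by (elim disjE) (simp_all add: f_def power2_eq_square)
  qed (use True in \<open>simp add: f_def\<close>)
  then show ?thesis by blast
next
  case False
  then have n: "n \<ge> 2" using assms by simp
  show ?thesis
  proof (rule cross_polytope_embedding[OF wf_graph_S_join, of "{n, n - 1}" n "id(n := n + 1, n - 1 := n - 2)"])
    have "card ({..<n + 3} - {n, n - 1}) = n + 1"
      using n by (subst card_Diff_subset) auto
    then show "card (verts (gjoin (S_graph n) (edgeless 3)) - {n, n - 1}) \<le> n + 1" by simp
  qed (use n in \<open>auto simp: edges_S_join\<close>)
qed

text \<open>What remains is contained in a path with three vertices together with the isolated leaf
  \<open>v\<close>, and this fits on a line.\<close>

lemma claw_minus_edge_embedding: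
  assumes wf: "wf_graph H" and verts: "verts H = {..<4}"
    and notH: "\<And>i j. {i, j} \<notin> edges (gjoin (S_graph 1) (edgeless 3)) \<Longrightarrow> {i, j} \<notin> edges H"
    and uv: "{u, v} \<in> edges (gjoin (S_graph 1) (edgeless 3))" "{u, v} \<notin> edges H" "u < 1" "v < 4"
  shows "\<exists>f. unit_dist_emb H 1 f"
proof -
  define T where "T = {1, 2, 3} - {v}"
  have "u = 0" "v \<in> {1, 2, 3}" using uv by (auto simp: edges_S_join)
  then have "card T = 2" by (auto simp: T_def)
  then obtain a b where ab: "T = {a, b}" "a \<noteq> b" by (auto simp: card_2_iff)
  have V: "verts H = {0, v, a, b}"
  proof -
    have "{..<4} = {0} \<union> {1, 2, 3::nat}"
      by (rule set_eqI, unfold lessThan_iff insert_iff empty_iff Un_iff) presburger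
    also have "{1, 2, 3} = {v} \<union> T" using \<open>v \<in> {1, 2, 3}\<close> by (auto simp: T_def)
    finally show ?thesis using ab(1) by (auto simp: verts)
  qed
  have dist: "distinct [0, v, a, b]"
  proof -
    have "a \<in> T" "b \<in> T" using ab(1) by auto
    then show ?thesis using ab(2) \<open>v \<in> {1, 2, 3}\<close> by (auto simp: T_def)
  qed
  have nonadj: "{i, j} \<notin> edges H" if "i > 0" "j > 0" for i j
    using that by (intro notH) (auto simp: edges_S_join)
  \<comment> \<open>The path occupies -1, 0, 1; the value 5 merely keeps \<open>v\<close> at
    distance at least 1 from it.\<close>
  define f :: "nat \<Rightarrow> nat \<Rightarrow> real" where
    "f w i = (if i > 0 \<or> w = 0 then 0 else if w = v then 5 else if w = a then 1 else - 1)" for w i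
  have "unit_dist_emb H 1 f"
  proof (rule unit_dist_emb_separated[OF wf])
    fix i j assume ij: "i \<in> verts H" "j \<in> verts H" "i \<noteq> j"
    show "sqdist 1 (f i) (f j) \<ge> 1"
      using ij dist unfolding V by (auto simp: f_def sqdist_def)
    assume "{i, j} \<in> edges H"
    then have "(i, j) \<in> {(0, a), (0, b), (a, 0), (b, 0)}"
      using ij dist nonadj[of i j] uv(2) \<open>u = 0\<close> unfolding V by (auto simp: insert_commute)
    then show "sqdist 1 (f i) (f j) = 1"
      using dist by (auto simp: f_def sqdist_def)
  qed (simp add: f_def)
  then show ?thesis by blast
qed

text \<open>Five vertices cannot contain the three disjoint pairs that the cross-polytope in the
  plane would need. Instead, the graph lies in a 4-cycle with one pendant edge, which is drawn in
  the plane.\<close>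

lemma K23_minus_edge_embedding:
  assumes wf: "wf_graph H" and verts: "verts H = {..<5}"
    and notH: "\<And>i j. {i, j} \<notin> edges (gjoin (S_graph 2) (edgeless 3)) \<Longrightarrow> {i, j} \<notin> edges H"
    and uv: "{u, v} \<in> edges (gjoin (S_graph 2) (edgeless 3))" "{u, v} \<notin> edges H" "u < 2" "v < 5"
  shows "\<exists>f. unit_dist_emb H 2 f"
proof -
  define T where "T = {2, 3, 4} - {v}"
  define u' where "u' = 1 - u"
  have uv': "{u, u'} = {0, 1}" "v \<in> {2, 3, 4}" using uv by (auto simp: edges_S_join u'_def)
  then have "card T = 2" by (auto simp: T_def)
  then obtain a b where ab: "T = {a, b}" "a \<noteq> b" by (auto simp: card_2_iff)
  have "{..<5} = {0, 1} \<union> {2, 3, 4::nat}"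
    by (rule set_eqI, unfold lessThan_iff insert_iff empty_iff Un_iff) presburger
  also have "{2, 3, 4} = {v} \<union> T" using uv'(2) by (auto simp: T_def)
  finally have "verts H = {0, 1} \<union> ({v} \<union> T)" by (simp add: verts)
  then have V: "verts H = {u, u', v, a, b}" unfolding ab(1) uv'(1)[symmetric] by auto
  have small: "u \<le> 1" "u' \<le> 1" "u \<noteq> u'" using uv(3) unfolding u'_def by presburger+
  have "a \<in> T" "b \<in> T" using ab(1) by auto
  then have large: "a \<ge> 2" "b \<ge> 2" "v \<ge> 2" "a \<noteq> v" "b \<noteq> v" using uv'(2) by (auto simp: T_def)
  with small have dist: "distinct [u, u', v, a, b]" using ab(2) by auto
  have nonadj: "{i, j} \<notin> edges H" if "i \<ge> 2 \<and> j \<ge> 2 \<or> i \<le> 1 \<and> j \<le> 1" for i j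
    using that by (intro notH) (auto simp: edges_S_join)
  \<comment> \<open>a unit square with diagonals \<open>u u'\<close> and \<open>a b\<close>, and a pendant edge \<open>u' v\<close>\<close>
  define p :: "nat \<Rightarrow> real \<times> real" where
    "p w = (if w = u' then (0, 0) else if w = a then (1, 0) else if w = b then (0, 1)
      else if w = u then (1, 1) else (- 1, 0))" for w
  define f :: "nat \<Rightarrow> nat \<Rightarrow> real" where
    "f w i = (if i = 0 then fst (p w) else if i = 1 then snd (p w) else 0)" for w i
  have sqdist: "sqdist 2 (f i) (f j) = (fst (p i) - fst (p j))\<^sup>2 + (snd (p i) - snd (p j))\<^sup>2" for i j
    by (simp add: sqdist_def f_def numeral_2_eq_2)
  have "unit_dist_emb H 2 f"
  proof (rule unit_dist_emb_separated[OF wf])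
    fix i j assume ij: "i \<in> verts H" "j \<in> verts H" "i \<noteq> j"
    show "sqdist 2 (f i) (f j) \<ge> 1"
      using ij dist unfolding V sqdist by (auto simp: p_def)
    assume e: "{i, j} \<in> edges H"
    have "\<not> (i \<ge> 2 \<and> j \<ge> 2 \<or> i \<le> 1 \<and> j \<le> 1)" "{i, j} \<noteq> {u, v}" using nonadj e uv(2) by auto
    then have "(i, j) \<in> {(u', a), (u', b), (u', v), (u, a), (u, b)} \<or>
        (j, i) \<in> {(u', a), (u', b), (u', v), (u, a), (u, b)}"
      using ij small(1,2) large(1-3) unfolding V by auto
    then show "sqdist 2 (f i) (f j) = 1"
      using dist unfolding sqdist by (auto simp: p_def)
  qed (simp add: f_def)
  then show ?thesis by blast
qed

text \<open>The deleted edge has at most one end in each of the two independent triples, so each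
  triple retains a pair avoiding it. These two pairs and the deleted edge are three disjoint
  non-adjacent pairs, which leaves \<open>n\<close> axes.\<close>

lemma S_join_minus_edge_embedding_ge_3:
  assumes n: "n \<ge> 3" and wf: "wf_graph H" and verts: "verts H = {..<n + 3}"
    and notH: "\<And>i j. {i, j} \<notin> edges (gjoin (S_graph n) (edgeless 3)) \<Longrightarrow> {i, j} \<notin> edges H"
    and uv: "{u, v} \<in> edges (gjoin (S_graph n) (edgeless 3))" "{u, v} \<notin> edges H" "u < n" "v < n + 3"
  shows "\<exists>f. unit_dist_emb H n f"
proof -
  define A B where "A = {n..<n + 3}" "B = {n - 3..<n}"
  have AB: "finite A" "finite B" "card A = 3" "card B = 3"
    using n by (auto simp: A_B_def)
  have two: "\<exists>x y. x \<in> T - {u, v} \<and> y \<in> T - {u, v} \<and> x \<noteq> y"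
    if "finite T" "card T = 3" "\<not> (u \<in> T \<and> v \<in> T)" for T
  proof -
    have "card (T - {u, v}) = card T - card (T \<inter> {u, v})"
      using card_Diff_subset_Int[of T "{u, v}"] by simp
    moreover have "card (T \<inter> {u, v}) \<le> 1" using that(3) by (auto simp: Int_insert_right)
    ultimately have "card (T - {u, v}) \<ge> 2" using that(2) by simp
    then show ?thesis by (auto simp: numeral_2_eq_2 card_le_Suc_iff)
  qed
  obtain x1 y1 where 1: "x1 \<in> A - {u, v}" "y1 \<in> A - {u, v}" "x1 \<noteq> y1"
    using two[of A] AB uv(1) by (auto simp: edges_S_join A_B_def)
  obtain x2 y2 where 2: "x2 \<in> B - {u, v}" "y2 \<in> B - {u, v}" "x2 \<noteq> y2"
    using two[of B] AB uv(1) by (auto simp: edges_S_join A_B_def)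
  have ne: "u \<noteq> v" using uv(1) by (simp add: edges_S_join)
  have dist: "distinct [x1, y1, x2, y2, u, v]"
    using 1 2 ne by (auto simp: A_B_def)
  show ?thesis
  proof (rule cross_polytope_embedding[OF wf, of "{y1, y2, v}" "id(y1 := x1, y2 := x2, v := u)"])
    have sub: "{y1, y2, v} \<subseteq> {..<n + 3}" using 1 2 uv by (auto simp: A_B_def)
    then show "{y1, y2, v} \<subseteq> verts H" using verts by simp
    have "card {y1, y2, v} = 3" using dist by auto
    then show "card (verts H - {y1, y2, v}) \<le> n" using sub by (simp add: verts card_Diff_subset)
    show "inj_on (id(y1 := x1, y2 := x2, v := u)) {y1, y2, v}"
      using dist by (auto simp: inj_on_def)
    show "(id(y1 := x1, y2 := x2, v := u)) ` {y1, y2, v} \<subseteq> verts H - {y1, y2, v}"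
      using 1 2 dist uv verts by (auto simp: A_B_def)
    show "{y, (id(y1 := x1, y2 := x2, v := u)) y} \<notin> edges H" if "y \<in> {y1, y2, v}" for y
    proof -
      have "{y1, x1} \<notin> edges H" "{y2, x2} \<notin> edges H"
        using 1 2 by (auto intro!: notH simp: edges_S_join A_B_def)
      then show ?thesis using that dist uv(2) by (auto simp: insert_commute)
    qed
  qed
qed

lemma S_join_minus_edge_embedding:
  assumes "n \<ge> 1" and wf: "wf_graph H" and verts: "verts H = {..<n + 3}"
    and edges: "edges H \<subset> edges (gjoin (S_graph n) (edgeless 3))"
  shows "\<exists>f. unit_dist_emb H n f"
proof -
  let ?G = "gjoin (S_graph n) (edgeless 3)"
  obtain e where e: "e \<in> edges ?G" "e \<notin> edges H" using edges by blast
  then obtain a b where ab: "{a, b} \<in> edges ?G" "{a, b} \<notin> edges H"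
    using wf_graph_S_join[of n] unfolding wf_graph_def by metis
  \<comment> \<open>Since \<open>\<epsilon>\<^sub>3\<close> spans no edge, the deleted edge has an
    end in the copy of \<open>S\<^sub>n\<close>; it is named \<open>u\<close>.\<close>
  obtain u v where uv: "{u, v} \<in> edges ?G" "{u, v} \<notin> edges H" "u < n" "v < n + 3"
  proof (cases "a < n")
    case True
    then show ?thesis using that[of a b] ab by (simp add: edges_S_join)
  next
    case False
    then have "b < n" "a < n + 3" using ab(1) by (auto simp: edges_S_join)
    then show ?thesis using that[of b a] ab by (simp add: insert_commute)
  qed
  have notH: "{i, j} \<notin> edges H" if "{i, j} \<notin> edges ?G" for i j using that edges by blast
  consider "n = 1" | "n = 2" | "n \<ge> 3" using assms(1) by linarith
  then show ?thesis
  proof cases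
    case 1
    then show ?thesis using claw_minus_edge_embedding[OF wf] notH uv verts by simp
  next
    case 2
    then show ?thesis using K23_minus_edge_embedding[OF wf] notH uv verts by simp
  next
    case 3
    then show ?thesis using S_join_minus_edge_embedding_ge_3[OF _ wf verts notH uv] by blast
  qed
qed

theorem mainTheorem20:
  fixes n :: nat
  assumes "n \<ge> 1"
  shows "gdim (gjoin (S_graph n) (edgeless 3)) = n + 1 \<and>
         (\<forall>H :: 'b ugraph. proper_minor H (gjoin (S_graph n) (edgeless 3)) \<longrightarrow> gdim H < n + 1)"
proof (intro conjI allI impI)
  let ?G = "gjoin (S_graph n) (edgeless 3)"
  have "\<exists>f. unit_dist_emb ?G (n + 1) f" using S_join_embedding[OF assms] .
  then show "gdim ?G = n + 1"
    unfolding gdim_def by (rule Least_equality) (use S_join_embedding_bound assms in blast)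
  fix H :: "'b ugraph"
  assume "proper_minor H ?G"
  then obtain K where K: "minor_step\<^sup>+\<^sup>+ K ?G" and iso: "graph_iso K H"
    by (auto simp: proper_minor_def)
  \<comment> \<open>The copy of \<open>\<epsilon>\<^sub>3\<close> serves as the independent triple
    in the classification of proper minors.\<close>
  have "{n..<n + 3} \<subseteq> verts ?G" "card {n..<n + 3} = 3" by auto
  moreover have "{x, y} \<notin> edges ?G" if "x \<in> {n..<n + 3}" "y \<in> {n..<n + 3}" for x y
    using that by (simp add: edges_S_join)
  ultimately have K_cases: "wf_graph K \<and>
    (verts K = verts ?G \<and> edges K \<subset> edges ?G \<or>
     card (verts K) + 1 = card (verts ?G) \<and> (\<exists>x\<in>verts K. \<exists>y\<in>verts K. x \<noteq> y \<and> {x, y} \<notin> edges K) \<or>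
     card (verts K) + 2 \<le> card (verts ?G))"
    by (rule proper_minor_cases[OF wf_graph_S_join _ _ _ K])
  then have wfK: "wf_graph K" by blast
  have "\<exists>f. unit_dist_emb K n f"
    using conjunct2[OF K_cases]
  proof (elim disjE conjE bexE)
    assume "verts K = verts ?G" "edges K \<subset> edges ?G"
    then show ?thesis using S_join_minus_edge_embedding[OF assms wfK] by simp
  next
    fix x y assume "card (verts K) + 1 = card (verts ?G)"
      "x \<in> verts K" "y \<in> verts K" "x \<noteq> y" "{x, y} \<notin> edges K"
    then show ?thesis using incomplete_graph_embedding[OF wfK assms] by simp
  next
    assume "card (verts K) + 2 \<le> card (verts ?G)"
    then show ?thesis using small_graph_embedding[OF wfK assms] by simp
  qed
  then obtain f where f: "unit_dist_emb K n f" by blast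
  then obtain f' where "unit_dist_emb H n f'" using unit_dist_emb_graph_iso[OF wfK iso] by blast
  then have "gdim H \<le> n" unfolding gdim_def by (blast intro: Least_le)
  then show "gdim H < n + 1" by simp
qed

end
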